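(* Let $\overline{Ra}=\{Ra,+,-,\times,\div,<,0,1\}$ be the rational number structure, let $r$ be any nonzero rational number, and let $\overline{Ra}^{r}$ and $\overline{Ra}_{r}$ be the external and internal representations of the structure scaled by $r$. Then $\overline{Ra}$ satisfies the rational number axioms if and only if $\overline{Ra}^{r}$ satisfies the axioms if and only if $\overline{Ra}_{r}$ does.
   Context: The rational number axioms are those of the smallest ordered field: a structure satisfies them if it is an ordered field, in the language $\{+,-,\times,\div,<,0,1\}$, and it is smallest, i.e. every ordered field contains it up to isomorphism (there is an embedding of ordered fields into every ordered field). Elements of $Ra$ are identified with their values in $\overline{Ra}$. External representation: for $r>0$, $\overline{Ra}^{r}=\{Ra,+,-,\frac{\times}{r},r\div,<,0,r\}$, the structure on the same set $Ra$ with the same $+,-,<$ as $\overline{Ra}$, with multiplication $x\,\frac{\times}{r}\,y:=(x\times y)\div r$, division $x\,(r\div)\,y:=r\times(x\div y)$, additive identity $0$ and multiplicative identity $r$ (right-hand sides computed in $\overline{Ra}$). For $r<0$ the definition is the same except that $<$ is replaced by $>$, i.e. $x$ is less than $y$ in $\overline{Ra}^{r}$ if and only if $x>y$ in $\overline{Ra}$. Internal representation: $\overline{Ra}_{r}=\{Ra,+_{r},-_{r},\times_{r},\div_{r},<_{r},0_{r},1_{r}\}$ is the same structure with values renamed: the element whose value in $\overline{Ra}$ is $ra$ has value denoted $a_{r}$ in $\overline{Ra}_{r}$, and the operations, the order relation and the constants are those of $\overline{Ra}^{r}$ transported along this renaming. *)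

theory Defs
  imports Complex_Main "HOL-Algebra.Ring"
begin

text \<open>
  Structures for the language of ordered fields extend the library's ring records by a binary
  subtraction, a binary division and a strict order. Division is a total function, but its values
  at divisor zero are never constrained.
\<close>

record 'a of_structure = "'a ring" +
  sub :: "'a \<Rightarrow> 'a \<Rightarrow> 'a"
  quot :: "'a \<Rightarrow> 'a \<Rightarrow> 'a"
  lt :: "'a \<Rightarrow> 'a \<Rightarrow> bool"

definition ordered_field :: "'a of_structure \<Rightarrow> bool" where
  "ordered_field S \<longleftrightarrow>
     field S \<and>
     (\<forall>x\<in>carrier S. \<forall>y\<in>carrier S. sub S x y = x \<ominus>\<^bsub>S\<^esub> y) \<and>
     (\<forall>x\<in>carrier S. \<forall>y\<in>carrier S - {\<zero>\<^bsub>S\<^esub>}. quot S x y = x \<otimes>\<^bsub>S\<^esub> inv\<^bsub>S\<^esub> y) \<and>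
     (\<forall>x\<in>carrier S. \<not> lt S x x) \<and>
     (\<forall>x\<in>carrier S. \<forall>y\<in>carrier S. \<forall>z\<in>carrier S. lt S x y \<longrightarrow> lt S y z \<longrightarrow> lt S x z) \<and>
     (\<forall>x\<in>carrier S. \<forall>y\<in>carrier S. lt S x y \<or> x = y \<or> lt S y x) \<and>
     (\<forall>x\<in>carrier S. \<forall>y\<in>carrier S. \<forall>z\<in>carrier S.
        lt S x y \<longrightarrow> lt S (x \<oplus>\<^bsub>S\<^esub> z) (y \<oplus>\<^bsub>S\<^esub> z)) \<and>
     (\<forall>x\<in>carrier S. \<forall>y\<in>carrier S.
        lt S \<zero>\<^bsub>S\<^esub> x \<longrightarrow> lt S \<zero>\<^bsub>S\<^esub> y \<longrightarrow> lt S \<zero>\<^bsub>S\<^esub> (x \<otimes>\<^bsub>S\<^esub> y))"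

definition of_embedding :: "'a of_structure \<Rightarrow> 'b of_structure \<Rightarrow> ('a \<Rightarrow> 'b) \<Rightarrow> bool" where
  "of_embedding S F h \<longleftrightarrow>
     h \<in> ring_hom S F \<and> inj_on h (carrier S) \<and> h \<zero>\<^bsub>S\<^esub> = \<zero>\<^bsub>F\<^esub> \<and>
     (\<forall>x\<in>carrier S. \<forall>y\<in>carrier S. h (sub S x y) = sub F (h x) (h y)) \<and>
     (\<forall>x\<in>carrier S. \<forall>y\<in>carrier S - {\<zero>\<^bsub>S\<^esub>}. h (quot S x y) = quot F (h x) (h y)) \<and>
     (\<forall>x\<in>carrier S. \<forall>y\<in>carrier S. lt S x y \<longleftrightarrow> lt F (h x) (h y))"

text \<open>
  A formula cannot quantify over types, so the ambient type of the ordered fields that have to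
  contain \<open>S\<close> is a parameter. Minimality among all ordered fields is the
  conjunction over all instances of the type variable \<open>'b\<close>.
\<close>

definition rational_axioms :: "'b itself \<Rightarrow> 'a of_structure \<Rightarrow> bool" where
  "rational_axioms _ S \<longleftrightarrow>
     ordered_field S \<and> (\<forall>F :: 'b of_structure. ordered_field F \<longrightarrow> (\<exists>h. of_embedding S F h))"

definition Ra_bar :: "rat of_structure" where
  "Ra_bar = \<lparr>carrier = UNIV, mult = (*), one = 1, zero = 0, add = (+),
             sub = (-), quot = (/), lt = (<)\<rparr>"

definition external :: "'a of_structure \<Rightarrow> 'a \<Rightarrow> 'a of_structure" where
  "external S r = \<lparr>carrier = carrier S,
     mult = (\<lambda>x y. quot S (x \<otimes>\<^bsub>S\<^esub> y) r), one = r, zero = \<zero>\<^bsub>S\<^esub>, add = add S,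
     sub = sub S, quot = (\<lambda>x y. r \<otimes>\<^bsub>S\<^esub> quot S x y),
     lt = (if lt S \<zero>\<^bsub>S\<^esub> r then lt S else (\<lambda>x y. lt S y x))\<rparr>"

text \<open>\<open>Sub a r\<close> is the subscripted value $a_r$; it names the element $ra$.\<close>

datatype 'a subscripted = Sub 'a 'a

primrec element :: "'a of_structure \<Rightarrow> 'a subscripted \<Rightarrow> 'a" where
  "element S (Sub a r) = r \<otimes>\<^bsub>S\<^esub> a"

text \<open>
  The structure whose elements are the names in \<open>C\<close>, where \<open>e\<close> sends a name to the element of
  \<open>S\<close> it denotes; meaningful when \<open>e\<close> is a bijection from \<open>C\<close> onto the carrier of \<open>S\<close>.
\<close>

definition rename :: "('b \<Rightarrow> 'a) \<Rightarrow> 'b set \<Rightarrow> 'a of_structure \<Rightarrow> 'b of_structure" where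
  "rename e C S = (let n = inv_into C e in
     \<lparr>carrier = C,
      mult = (\<lambda>x y. n (e x \<otimes>\<^bsub>S\<^esub> e y)), one = n \<one>\<^bsub>S\<^esub>, zero = n \<zero>\<^bsub>S\<^esub>,
      add = (\<lambda>x y. n (e x \<oplus>\<^bsub>S\<^esub> e y)),
      sub = (\<lambda>x y. n (sub S (e x) (e y))), quot = (\<lambda>x y. n (quot S (e x) (e y))),
      lt = (\<lambda>x y. lt S (e x) (e y))\<rparr>)"

definition internal :: "'a of_structure \<Rightarrow> 'a \<Rightarrow> 'a subscripted of_structure" where
  "internal S r = rename (element S) {Sub a r |a. a \<in> carrier S} (external S r)"

end

theory Submission
  imports Defs "HOL-Algebra.QuotRing"
begin

text \<open>
  Scaling is an isomorphism. Multiplication by \<open>r\<close> carries the rational structure onto its external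
  representation: \<open>(rx)(ry)/r = r(xy)\<close>, \<open>r(rx/(ry)) = r(x/y)\<close>, the identity \<open>1\<close> goes to \<open>r\<close>, and the
  order is kept for \<open>r > 0\<close> and reversed for \<open>r < 0\<close>, which is why the external order is reversed in
  the second case (\<open>embedding_scaling\<close>). The internal representation is a renaming of the external
  one and so isomorphic to it as well (\<open>embedding_rename\<close>).

  The axioms are invariant under isomorphism (\<open>rational_axioms_isomorphic\<close>): the ordered field laws
  are transported along the bijection, and embeddings into a given ordered field are obtained by
  composing with the isomorphism or with its inverse. The three structures are thus ordered fields
  with the same embeddings into other ordered fields. This reasoning fixes one target field at a
  time, so it is uniform in the type over which the target fields range.
\<close>

section \<open>Isomorphisms of ordered fields\<close>

lemma ordered_fieldD:
  assumes "ordered_field S"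
  shows "field S"
    and ordered_field_sub [rule_format]:
      "\<forall>x\<in>carrier S. \<forall>y\<in>carrier S. sub S x y = x \<ominus>\<^bsub>S\<^esub> y"
    and ordered_field_quot [rule_format]:
      "\<forall>x\<in>carrier S. \<forall>y\<in>carrier S - {\<zero>\<^bsub>S\<^esub>}. quot S x y = x \<otimes>\<^bsub>S\<^esub> inv\<^bsub>S\<^esub> y"
    and ordered_field_irrefl [rule_format]: "\<forall>x\<in>carrier S. \<not> lt S x x"
    and ordered_field_trans [rule_format]:
      "\<forall>x\<in>carrier S. \<forall>y\<in>carrier S. \<forall>z\<in>carrier S. lt S x y \<longrightarrow> lt S y z \<longrightarrow> lt S x z"
    and ordered_field_total [rule_format]:
      "\<forall>x\<in>carrier S. \<forall>y\<in>carrier S. lt S x y \<or> x = y \<or> lt S y x"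
    and ordered_field_add_mono [rule_format]:
      "\<forall>x\<in>carrier S. \<forall>y\<in>carrier S. \<forall>z\<in>carrier S.
         lt S x y \<longrightarrow> lt S (x \<oplus>\<^bsub>S\<^esub> z) (y \<oplus>\<^bsub>S\<^esub> z)"
    and ordered_field_mult_pos [rule_format]:
      "\<forall>x\<in>carrier S. \<forall>y\<in>carrier S.
         lt S \<zero>\<^bsub>S\<^esub> x \<longrightarrow> lt S \<zero>\<^bsub>S\<^esub> y \<longrightarrow> lt S \<zero>\<^bsub>S\<^esub> (x \<otimes>\<^bsub>S\<^esub> y)"
  using assms unfolding ordered_field_def by - (elim conjE, assumption)+

text \<open>An isomorphism is treated throughout as an embedding whose image is the whole carrier.\<close>

lemma of_embedding_comp:
  assumes S: "ordered_field S"
    and g: "of_embedding S T g" and h: "of_embedding T F h"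
  shows "of_embedding S F (h \<circ> g)"
proof -
  interpret field S using S by (rule ordered_fieldD)
  have g_carrier: "g x \<in> carrier T" if "x \<in> carrier S" for x
    using g that by (auto simp: of_embedding_def ring_hom_def)
  have g_nonzero: "g x \<noteq> \<zero>\<^bsub>T\<^esub>" if "x \<in> carrier S" "x \<noteq> \<zero>\<^bsub>S\<^esub>" for x
    using g that zero_closed unfolding of_embedding_def by (metis inj_onD)
  have "h \<circ> g \<in> ring_hom S F"
    using g h by (auto simp: of_embedding_def intro: ring_hom_trans)
  moreover have "inj_on (h \<circ> g) (carrier S)"
    using g h g_carrier by (auto simp: of_embedding_def inj_on_def)
  ultimately show ?thesis
    using g h g_carrier g_nonzero by (simp add: of_embedding_def)
qed

text \<open>
  Inverting the equations for subtraction and division requires that their results stay in the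
  carrier. The ordered field laws provide this by expressing both through the field operations.
\<close>

lemma of_embedding_inverse:
  assumes S: "ordered_field S"
    and g: "of_embedding S T g" and onto: "g ` carrier S = carrier T"
  shows "of_embedding T S (inv_into (carrier S) g)"
proof -
  interpret field S using S by (rule ordered_fieldD)
  let ?k = "inv_into (carrier S) g"
  have inj: "inj_on g (carrier S)" using g by (simp add: of_embedding_def)
  have kg [simp]: "?k (g x) = x" if "x \<in> carrier S" for x
    using inj that by simp
  have iso: "g \<in> ring_iso S T"
    using g onto by (auto simp: of_embedding_def ring_iso_def bij_betw_def)
  have "?k \<in> ring_hom T S"
    using ring_iso_set_sym[OF ring_axioms iso] by (simp add: ring_iso_def)
  moreover have "inj_on ?k (carrier T)"
    using onto by (metis inj_on_inv_into order_refl)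
  moreover have zero: "?k \<zero>\<^bsub>T\<^esub> = \<zero>\<^bsub>S\<^esub>"
    using g kg[OF zero_closed] by (simp add: of_embedding_def)
  moreover have "?k (sub T u v) = sub S (?k u) (?k v)"
    if uv: "u \<in> carrier T" "v \<in> carrier T" for u v
  proof -
    obtain x y where xy: "x \<in> carrier S" "y \<in> carrier S" "u = g x" "v = g y"
      using uv unfolding onto[symmetric] by blast
    then have "sub S x y = x \<ominus>\<^bsub>S\<^esub> y" using S by (simp add: ordered_field_sub)
    then have "sub S x y \<in> carrier S" using xy by simp
    then have "?k (g (sub S x y)) = sub S x y" by simp
    then show ?thesis using g xy by (simp add: of_embedding_def)
  qed
  moreover have "?k (quot T u v) = quot S (?k u) (?k v)"
    if uv: "u \<in> carrier T" "v \<in> carrier T - {\<zero>\<^bsub>T\<^esub>}" for u v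
  proof -
    obtain x y where xy: "x \<in> carrier S" "y \<in> carrier S" "u = g x" "v = g y"
      using uv unfolding onto[symmetric] by blast
    then have y: "y \<in> carrier S - {\<zero>\<^bsub>S\<^esub>}"
      using uv g by (auto simp: of_embedding_def)
    then have "quot S x y = x \<otimes>\<^bsub>S\<^esub> inv\<^bsub>S\<^esub> y"
      using S xy y by (simp add: ordered_field_quot)
    then have "quot S x y \<in> carrier S" using xy y by (simp add: field_Units)
    then have "?k (g (quot S x y)) = quot S x y" by simp
    then show ?thesis using g xy y by (simp add: of_embedding_def)
  qed
  moreover have "lt T u v \<longleftrightarrow> lt S (?k u) (?k v)"
    if "u \<in> carrier T" "v \<in> carrier T" for u v
    using that g by (auto simp: of_embedding_def onto[symmetric])
  ultimately show ?thesis by (simp add: of_embedding_def)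
qed

text \<open>
  Subtraction and division are tied to the field operations by laws mentioning additive and
  multiplicative inverses. These laws transfer because an isomorphism commutes with both inverses.
\<close>

lemma ordered_field_isomorphic:
  assumes S: "ordered_field S"
    and g: "of_embedding S T g" and onto: "g ` carrier S = carrier T"
  shows "ordered_field T"
proof -
  interpret S: field S using S by (rule ordered_fieldD)
  have hom: "g \<in> ring_hom S T" and inj: "inj_on g (carrier S)"
    and zero: "g \<zero>\<^bsub>S\<^esub> = \<zero>\<^bsub>T\<^esub>"
    using g by (auto simp: of_embedding_def)
  have iso: "g \<in> ring_iso S T"
    using hom inj onto by (auto simp: ring_iso_def bij_betw_def)
  interpret T: field T
    using S.ring_iso_imp_img_field[OF iso] zero by simp
  interpret ring_hom_ring S T g
    using S.ring_axioms T.ring_axioms hom by (rule ring_hom_ringI2)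
  have nonzero: "g x = \<zero>\<^bsub>T\<^esub> \<longleftrightarrow> x = \<zero>\<^bsub>S\<^esub>" if "x \<in> carrier S" for x
    using inj that zero by (metis S.zero_closed inj_onD)
  have inverse: "g (inv\<^bsub>S\<^esub> x) = inv\<^bsub>T\<^esub> g x" if "x \<in> carrier S" "x \<noteq> \<zero>\<^bsub>S\<^esub>" for x
  proof -
    have x: "x \<in> Units S" using that by (simp add: S.field_Units)
    then have "g x \<otimes>\<^bsub>T\<^esub> g (inv\<^bsub>S\<^esub> x) = \<one>\<^bsub>T\<^esub>"
      using that by (metis S.Units_inv_closed S.Units_r_inv hom_mult hom_one)
    then show ?thesis
      using x that by (metis T.comm_inv_char S.Units_inv_closed hom_closed)
  qed
  have lt: "lt T (g x) (g y) \<longleftrightarrow> lt S x y" if "x \<in> carrier S" "y \<in> carrier S" for x y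
    using g that by (simp add: of_embedding_def)
  have sub: "sub T (g x) (g y) = g x \<ominus>\<^bsub>T\<^esub> g y" if "x \<in> carrier S" "y \<in> carrier S" for x y
  proof -
    have "sub T (g x) (g y) = g (sub S x y)"
      using g that by (simp add: of_embedding_def)
    also have "sub S x y = x \<ominus>\<^bsub>S\<^esub> y"
      using S that by (simp add: ordered_field_sub)
    finally show ?thesis using that by (simp add: a_minus_def)
  qed
  have quot: "quot T (g x) (g y) = g x \<otimes>\<^bsub>T\<^esub> inv\<^bsub>T\<^esub> g y"
    if "x \<in> carrier S" "y \<in> carrier S" "y \<noteq> \<zero>\<^bsub>S\<^esub>" for x y
  proof -
    have "quot T (g x) (g y) = g (quot S x y)"
      using g that by (simp add: of_embedding_def)
    also have "quot S x y = x \<otimes>\<^bsub>S\<^esub> inv\<^bsub>S\<^esub> y"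
      using S that by (simp add: ordered_field_quot)
    finally show ?thesis using that inverse by (simp add: S.field_Units)
  qed
  have irrefl: "\<not> lt T (g x) (g x)" if "x \<in> carrier S" for x
    using ordered_field_irrefl[OF S] that lt by blast
  have trans: "lt T (g x) (g z)"
    if "x \<in> carrier S" "y \<in> carrier S" "z \<in> carrier S" "lt T (g x) (g y)" "lt T (g y) (g z)"
    for x y z
    using ordered_field_trans[OF S] that lt by blast
  have total: "lt T (g x) (g y) \<or> g x = g y \<or> lt T (g y) (g x)"
    if "x \<in> carrier S" "y \<in> carrier S" for x y
    using ordered_field_total[OF S] that lt by blast
  have add: "lt T (g x \<oplus>\<^bsub>T\<^esub> g z) (g y \<oplus>\<^bsub>T\<^esub> g z)"
    if "x \<in> carrier S" "y \<in> carrier S" "z \<in> carrier S" "lt T (g x) (g y)" for x y z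
  proof -
    have "lt S (x \<oplus>\<^bsub>S\<^esub> z) (y \<oplus>\<^bsub>S\<^esub> z)"
      using ordered_field_add_mono[OF S] that lt by blast
    then show ?thesis using that lt[of "x \<oplus>\<^bsub>S\<^esub> z" "y \<oplus>\<^bsub>S\<^esub> z"] by simp
  qed
  have mult: "lt T \<zero>\<^bsub>T\<^esub> (g x \<otimes>\<^bsub>T\<^esub> g y)"
    if "x \<in> carrier S" "y \<in> carrier S" "lt T \<zero>\<^bsub>T\<^esub> (g x)" "lt T \<zero>\<^bsub>T\<^esub> (g y)" for x y
  proof -
    have "lt S \<zero>\<^bsub>S\<^esub> x" "lt S \<zero>\<^bsub>S\<^esub> y"
      using that zero lt[OF S.zero_closed] by simp_all
    then have "lt S \<zero>\<^bsub>S\<^esub> (x \<otimes>\<^bsub>S\<^esub> y)"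
      using ordered_field_mult_pos[OF S] that by blast
    then show ?thesis using that zero lt[of "\<zero>\<^bsub>S\<^esub>" "x \<otimes>\<^bsub>S\<^esub> y"] by simp
  qed
  \<comment> \<open>Every element of \<open>T\<close> is some \<open>g x\<close>, so each law may be read on the carrier of \<open>S\<close>.\<close>
  show ?thesis
    unfolding ordered_field_def onto[symmetric] ball_simps(9)
  proof (intro conjI ballI impI T.field_axioms)
    show "quot T (g x) v = g x \<otimes>\<^bsub>T\<^esub> inv\<^bsub>T\<^esub> v"
      if "x \<in> carrier S" "v \<in> g ` carrier S - {\<zero>\<^bsub>T\<^esub>}" for x v
      using that quot nonzero by auto
  qed (fact sub irrefl total add mult | rule trans; assumption)+
qed

lemma rational_axioms_isomorphic:
  assumes S: "ordered_field S"
    and g: "of_embedding S T g" and onto: "g ` carrier S = carrier T"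
  shows "rational_axioms TYPE('b) S \<longleftrightarrow> rational_axioms TYPE('b) T"
proof -
  have T: "ordered_field T" using ordered_field_isomorphic[OF assms] .
  have k: "of_embedding T S (inv_into (carrier S) g)" using of_embedding_inverse[OF assms] .
  have "(\<exists>h. of_embedding S F h) \<longleftrightarrow> (\<exists>h. of_embedding T F h)" for F :: "'b of_structure"
    using of_embedding_comp[OF S g] of_embedding_comp[OF T k] by blast
  then show ?thesis using S T by (simp add: rational_axioms_def)
qed

section \<open>The scaled representations\<close>

lemma Ra_bar_simps [simp]:
  "carrier Ra_bar = UNIV" "mult Ra_bar = (*)" "one Ra_bar = 1" "zero Ra_bar = 0"
  "add Ra_bar = (+)" "sub Ra_bar = (-)" "quot Ra_bar = (/)" "lt Ra_bar = (<)"
  by (simp_all add: Ra_bar_def)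

lemma ordered_field_Ra_bar: "ordered_field Ra_bar"
proof -
  have negative: "\<exists>y. y + x = 0" for x :: rat
    by (rule exI[of _ "- x"]) simp
  have reciprocal: "\<exists>y. x * y = 1" if "x \<noteq> 0" for x :: rat
    using that by (intro exI[of _ "inverse x"]) simp
  have "abelian_group Ra_bar"
    by (rule abelian_groupI) (simp_all add: negative)
  moreover have "comm_monoid Ra_bar"
    by (rule comm_monoidI) simp_all
  ultimately have cring: "cring Ra_bar"
    by (rule cringI) (simp add: distrib_right)
  interpret cring Ra_bar by (fact cring)
  have field: "field Ra_bar"
    by (rule cring_fieldI2) (simp_all add: reciprocal)
  have "\<ominus>\<^bsub>Ra_bar\<^esub> y = - y" for y
    by (rule minus_equality) simp_all
  then have minus: "x \<ominus>\<^bsub>Ra_bar\<^esub> y = x - y" for x y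
    by (simp add: a_minus_def)
  have inverse: "inv\<^bsub>Ra_bar\<^esub> y = inverse y" if "y \<noteq> 0" for y
    using that by (intro comm_inv_char) simp_all
  show ?thesis
    using field by (auto simp: ordered_field_def minus inverse divide_inverse)
qed

lemma embedding_scaling:
  assumes "r \<noteq> 0"
  shows "of_embedding Ra_bar (external Ra_bar r) ((*) r)"
  using assms
  by (simp add: of_embedding_def ring_hom_def external_def inj_on_def distrib_left
      right_diff_distrib mult_less_cancel_left)

text \<open>
  The isomorphism goes from elements to names: in this direction the operations of the renamed
  structure unfold directly, since \<open>e\<close> undoes the naming on the whole carrier.
\<close>

lemma embedding_rename:
  assumes "bij_betw e C (carrier S)"
  shows "of_embedding S (rename e C S) (inv_into C e)"
proof -
  have e: "e (inv_into C e x) = x" "inv_into C e x \<in> C" if "x \<in> carrier S" for x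
    using assms that by (auto simp: bij_betw_def f_inv_into_f inv_into_into)
  moreover have "inj_on (inv_into C e) (carrier S)"
    using assms by (metis bij_betw_def inj_on_inv_into order_refl)
  ultimately show ?thesis
    by (auto simp: of_embedding_def ring_hom_def rename_def Let_def)
qed

text \<open>
  The number \<open>x\<close> has exactly one name with subscript \<open>r\<close>, namely that of the value \<open>x / r\<close>; this is
  where the internal representation needs \<open>r \<noteq> 0\<close>.
\<close>

lemma element_bij:
  assumes "r \<noteq> 0"
  shows "bij_betw (element Ra_bar) {Sub a r |a. a \<in> carrier Ra_bar} (carrier (external Ra_bar r))"
proof -
  have "x \<in> element Ra_bar ` {Sub a r |a. a \<in> carrier Ra_bar}" for x
    using assms by (intro image_eqI[of _ _ "Sub (x / r) r"]) auto
  then show ?thesis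
    using assms by (auto simp: bij_betw_def inj_on_def external_def)
qed

theorem theorem5:
  fixes r :: rat
  assumes "r \<noteq> 0"
  shows "(rational_axioms TYPE('b) Ra_bar \<longleftrightarrow> rational_axioms TYPE('b) (external Ra_bar r)) \<and>
         (rational_axioms TYPE('b) (external Ra_bar r) \<longleftrightarrow> rational_axioms TYPE('b) (internal Ra_bar r))"
proof
  have "x \<in> range ((*) r)" for x
    using assms by (intro image_eqI[of _ _ "x / r"]) auto
  then have onto: "(*) r ` carrier Ra_bar = carrier (external Ra_bar r)"
    by (auto simp: external_def)
  note scaling = ordered_field_Ra_bar embedding_scaling[OF assms] onto
  show "rational_axioms TYPE('b) Ra_bar \<longleftrightarrow> rational_axioms TYPE('b) (external Ra_bar r)"
    using scaling by (rule rational_axioms_isomorphic)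
  let ?C = "{Sub a r |a. a \<in> carrier Ra_bar}"
  have "inv_into ?C (element Ra_bar) ` carrier (external Ra_bar r) = carrier (internal Ra_bar r)"
    using bij_betw_inv_into[OF element_bij[OF assms]]
    by (simp add: bij_betw_def internal_def rename_def Let_def)
  then show "rational_axioms TYPE('b) (external Ra_bar r) \<longleftrightarrow>
      rational_axioms TYPE('b) (internal Ra_bar r)"
    using ordered_field_isomorphic[OF scaling] embedding_rename[OF element_bij[OF assms]]
    by (intro rational_axioms_isomorphic) (auto simp: internal_def)
qed

end
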